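(* Let $T$ be the infinite rooted binary tree and let $\mathrm{Aut}(T)$ be the group of automorphisms of $T$, i.e. of bijections on the nodes of $T$ which preserve the root and the parent relation. Then $\mathrm{utww}(\mathrm{Aut}(T))=2$.
   Context: In the infinite rooted binary tree every node has exactly two children. For totally ordered sets $X,Y$, an $X\times Y$ matrix is a map $M:X\times Y\to\{0,1\}$. If $M$ is finite, a division of $M$ is a pair $(\mathcal X,\mathcal Y)$ of partitions of $X$ and $Y$ into intervals; the quotient $M/(\mathcal X,\mathcal Y)$ is the $\mathcal X\times\mathcal Y$ matrix with entry $1$ at $(X_i,Y_j)$ iff $M$ has a $1$-entry in $X_i\times Y_j$. A division sequence of $M$ is a sequence of divisions starting with the division into singletons, ending with $(\{X\},\{Y\})$, each obtained from the previous one by merging two (consecutive) parts of $\mathcal X$ or two of $\mathcal Y$. Its width is the maximum number of $1$-entries in a row or column of a quotient matrix along the sequence. The strict twin-width $\mathrm{stww}(M)$ is the minimum width of a division sequence; for infinite $M$ it is the supremum over finite submatrices. For a group $G$, a total order $<$ on $G$ and $g\in G$, let $M_g^<$ be the $(G,<)\times(G,<)$ matrix with $M_g^<(x,y)=1$ iff $xg=y$. The uniform twin-width is $\mathrm{utww}(G)=\min_{<}\ \sup_{g\in G}\mathrm{stww}(M_g^<)\in\mathbb N\cup\{\infty\}$, the minimum being over all total orders $<$ on $G$. *)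

theory Defs
  imports "HOL-Algebra.Bij" "HOL-Library.Disjoint_Sets" "HOL-Library.Extended_Nat"
begin

section \<open>Strict twin-width of matrices over totally ordered sets\<close>

text \<open>
  A totally ordered set is a carrier \<open>X\<close> with a relation \<open>r\<close> such that \<open>linear_order_on X r\<close>.
  A 0/1-matrix with rows \<open>(X, r)\<close> and columns \<open>(Y, s)\<close> is a predicate \<open>M\<close>, of which only the
  values on \<open>X \<times> Y\<close> matter. A submatrix is obtained by shrinking \<open>X\<close> and \<open>Y\<close>; the relations
  \<open>r\<close> and \<open>s\<close> need not be restricted along, since below they are only evaluated inside the carriers.
\<close>

definition interval_in :: "'a set \<Rightarrow> 'a rel \<Rightarrow> 'a set \<Rightarrow> bool" where
  "interval_in X r I \<longleftrightarrow> I \<subseteq> X \<and>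
     (\<forall>x\<in>I. \<forall>z\<in>I. \<forall>y\<in>X. (x, y) \<in> r \<and> (y, z) \<in> r \<longrightarrow> y \<in> I)"

definition interval_partition :: "'a set \<Rightarrow> 'a rel \<Rightarrow> 'a set set \<Rightarrow> bool" where
  "interval_partition X r P \<longleftrightarrow> partition_on X P \<and> (\<forall>I\<in>P. interval_in X r I)"

type_synonym ('a, 'b) division = "'a set set \<times> 'b set set"

definition is_division ::
  "'a set \<Rightarrow> 'a rel \<Rightarrow> 'b set \<Rightarrow> 'b rel \<Rightarrow> ('a, 'b) division \<Rightarrow> bool" where
  "is_division X r Y s D \<longleftrightarrow> interval_partition X r (fst D) \<and> interval_partition Y s (snd D)"

definition quotient_entry :: "('a \<Rightarrow> 'b \<Rightarrow> bool) \<Rightarrow> 'a set \<Rightarrow> 'b set \<Rightarrow> bool" where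
  "quotient_entry M I J \<longleftrightarrow> (\<exists>x\<in>I. \<exists>y\<in>J. M x y)"

definition merges_to :: "'a set set \<Rightarrow> 'a set set \<Rightarrow> bool" where
  "merges_to P P' \<longleftrightarrow> (\<exists>I\<in>P. \<exists>J\<in>P. I \<noteq> J \<and> P' = insert (I \<union> J) (P - {I, J}))"

definition division_step :: "('a, 'b) division \<Rightarrow> ('a, 'b) division \<Rightarrow> bool" where
  "division_step D D' \<longleftrightarrow>
     (merges_to (fst D) (fst D') \<and> snd D' = snd D) \<or>
     (fst D' = fst D \<and> merges_to (snd D) (snd D'))"

text \<open>
  Consecutiveness of merged parts is enforced by requiring every member of the sequence
  to be a division into intervals.
\<close>

definition division_sequence ::
  "'a set \<Rightarrow> 'a rel \<Rightarrow> 'b set \<Rightarrow> 'b rel \<Rightarrow> ('a, 'b) division list \<Rightarrow> bool" where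
  "division_sequence X r Y s Ds \<longleftrightarrow>
     Ds \<noteq> [] \<and>
     (\<forall>D\<in>set Ds. is_division X r Y s D) \<and>
     hd Ds = ((\<lambda>x. {x}) ` X, (\<lambda>y. {y}) ` Y) \<and>
     last Ds = ({X}, {Y}) \<and>
     (\<forall>i. Suc i < length Ds \<longrightarrow> division_step (Ds ! i) (Ds ! Suc i))"

definition line_counts :: "('a \<Rightarrow> 'b \<Rightarrow> bool) \<Rightarrow> ('a, 'b) division \<Rightarrow> nat set" where
  "line_counts M D =
     (\<lambda>I. card {J \<in> snd D. quotient_entry M I J}) ` fst D \<union>
     (\<lambda>J. card {I \<in> fst D. quotient_entry M I J}) ` snd D"

definition width :: "('a \<Rightarrow> 'b \<Rightarrow> bool) \<Rightarrow> ('a, 'b) division list \<Rightarrow> nat" where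
  "width M Ds = Max (\<Union>D\<in>set Ds. line_counts M D)"

definition stww_finite ::
  "'a set \<Rightarrow> 'a rel \<Rightarrow> 'b set \<Rightarrow> 'b rel \<Rightarrow> ('a \<Rightarrow> 'b \<Rightarrow> bool) \<Rightarrow> enat" where
  "stww_finite X r Y s M = (INF Ds \<in> {Ds. division_sequence X r Y s Ds}. enat (width M Ds))"

text \<open>
  Only nonempty finite submatrices are considered: \<open>{{}}\<close> is not a partition of \<open>{}\<close>,
  so a matrix without rows or columns has no division sequence.
\<close>

definition stww ::
  "'a set \<Rightarrow> 'a rel \<Rightarrow> 'b set \<Rightarrow> 'b rel \<Rightarrow> ('a \<Rightarrow> 'b \<Rightarrow> bool) \<Rightarrow> enat" where
  "stww X r Y s M =
     (if finite X \<and> finite Y then stww_finite X r Y s M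
      else (SUP (A, B) \<in> {(A, B). A \<subseteq> X \<and> finite A \<and> A \<noteq> {} \<and> B \<subseteq> Y \<and> finite B \<and> B \<noteq> {}}.
              stww_finite A r B s M))"


section \<open>Uniform twin-width of groups\<close>

definition mult_matrix :: "('a, 'm) monoid_scheme \<Rightarrow> 'a \<Rightarrow> 'a \<Rightarrow> 'a \<Rightarrow> bool" where
  "mult_matrix G g x y \<longleftrightarrow> x \<otimes>\<^bsub>G\<^esub> g = y"

text \<open>The infimum is attained, as \<open>enat\<close> is well-ordered and every set can be totally ordered.\<close>

definition utww :: "('a, 'm) monoid_scheme \<Rightarrow> enat" where
  "utww G = (INF r \<in> {r. linear_order_on (carrier G) r}.
     SUP g \<in> carrier G. stww (carrier G) r (carrier G) r (mult_matrix G g))"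


section \<open>The automorphism group of the infinite rooted binary tree\<close>

text \<open>
  A node is the list of left/right choices on the path from the root to it, most recent choice
  first: the root is \<open>[]\<close> and the two children of \<open>u\<close> are \<open>False # u\<close> and \<open>True # u\<close>.
\<close>

type_synonym node = "bool list"

definition parent_of :: "node \<Rightarrow> node \<Rightarrow> bool" where
  "parent_of u v \<longleftrightarrow> (\<exists>b. v = b # u)"

definition tree_automorphism :: "(node \<Rightarrow> node) \<Rightarrow> bool" where
  "tree_automorphism f \<longleftrightarrow>
     bij f \<and> f [] = [] \<and> (\<forall>u v. parent_of (f u) (f v) \<longleftrightarrow> parent_of u v)"

definition Aut_T :: "(node \<Rightarrow> node) monoid" where
  "Aut_T = BijGroup UNIV \<lparr>carrier := {f. tree_automorphism f}\<rparr>"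

lemma Bij_UNIV: "Bij UNIV = {f. bij f}"
  by (auto simp: Bij_def extensional_def)

lemma mult_Aut_T:
  assumes "tree_automorphism f" "tree_automorphism g"
  shows "f \<otimes>\<^bsub>Aut_T\<^esub> g = f \<circ> g"
  using assms
  by (auto simp: Aut_T_def BijGroup_def Bij_UNIV tree_automorphism_def compose_def fun_eq_iff)

lemma group_Aut_T: "group Aut_T"
proof (rule groupI)
  have one: "\<one>\<^bsub>Aut_T\<^esub> = id"
    by (auto simp: Aut_T_def BijGroup_def fun_eq_iff)
  have car: "carrier Aut_T = {f. tree_automorphism f}"
    by (simp add: Aut_T_def)
  have id: "tree_automorphism id"
    by (simp add: tree_automorphism_def)
  have comp: "tree_automorphism (f \<circ> g)" if "tree_automorphism f" "tree_automorphism g" for f g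
    using that by (auto simp: tree_automorphism_def intro: bij_comp)
  have inv: "tree_automorphism (inv_into UNIV f)" if f: "tree_automorphism f" for f
  proof -
    have b: "bij f" and r: "f [] = []" and p: "\<And>u v. parent_of (f u) (f v) \<longleftrightarrow> parent_of u v"
      using f by (auto simp: tree_automorphism_def)
    have "inv_into UNIV f [] = []"
      using b r by (metis bij_inv_eq_iff)
    moreover have "parent_of (inv_into UNIV f u) (inv_into UNIV f v) \<longleftrightarrow> parent_of u v" for u v
      using p[of "inv_into UNIV f u" "inv_into UNIV f v"] b by (simp add: bij_is_surj surj_f_inv_f)
    ultimately show ?thesis
      using b by (simp add: tree_automorphism_def bij_imp_bij_inv)
  qed
  show "\<one>\<^bsub>Aut_T\<^esub> \<in> carrier Aut_T"
    by (simp add: one car id)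
  fix x assume x: "x \<in> carrier Aut_T"
  show "\<one>\<^bsub>Aut_T\<^esub> \<otimes>\<^bsub>Aut_T\<^esub> x = x"
    using x id by (simp add: one car mult_Aut_T)
  show "\<exists>y\<in>carrier Aut_T. y \<otimes>\<^bsub>Aut_T\<^esub> x = \<one>\<^bsub>Aut_T\<^esub>"
    using x inv[of x]
    by (intro bexI[of _ "inv_into UNIV x"]) (auto simp: one car mult_Aut_T tree_automorphism_def bij_is_inj)
  fix y assume y: "y \<in> carrier Aut_T"
  show "x \<otimes>\<^bsub>Aut_T\<^esub> y \<in> carrier Aut_T"
    using x y comp by (simp add: car mult_Aut_T)
  fix z assume z: "z \<in> carrier Aut_T"
  show "x \<otimes>\<^bsub>Aut_T\<^esub> y \<otimes>\<^bsub>Aut_T\<^esub> z = x \<otimes>\<^bsub>Aut_T\<^esub> (y \<otimes>\<^bsub>Aut_T\<^esub> z)"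
    using x y z comp by (simp add: car mult_Aut_T comp_assoc)
qed

end

theory Submission
  imports Defs "HOL-Library.Discrete_Functions"
begin

text \<open>
  For the upper bound, order the automorphisms lexicographically along a sequence of bits
  \<open>c\<^sub>0, c\<^sub>1, \<dots>\<close> such that agreement on \<open>c\<^sub>0, \<dots>, c\<^sub>k\<^sub>-\<^sub>1\<close> is invariant under right multiplication;
  the classes of these relations form a binary tree on which every \<open>g\<close> acts by automorphisms.
  Merging sibling classes from the bottom up, a part always meets at most the two halves of one
  class, whence width at most 2.

  The bits come from the portrait of an automorphism, which records at every node whether its
  children are swapped. Right multiplication by \<open>g\<close> permutes the portrait by \<open>g\<close> and adds the
  portrait of \<open>g\<close>, so differences of portraits (in \<open>GF(2)\<close>) are merely permuted. On the space of
  functions on level \<open>n\<close> the group acts through a 2-group, hence stabilises a full flag, and the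
  bits are linear functionals adapted to such a flag.

  For the lower bound, the first merge applied to an identity matrix creates a line with two entries.
\<close>

section \<open>Lexicographic orders\<close>

text \<open>The classes of \<open>agree c k\<close> are the nodes at level \<open>k\<close> of a
  binary tree: bit \<open>c k\<close> splits each of them into at most two classes of level
  \<open>k + 1\<close>.\<close>

definition agree :: "(nat \<Rightarrow> 'a \<Rightarrow> bool) \<Rightarrow> nat \<Rightarrow> 'a \<Rightarrow> 'a \<Rightarrow> bool" where
  "agree c k x y \<longleftrightarrow> (\<forall>j<k. c j x = c j y)"

definition lex_less :: "(nat \<Rightarrow> 'a \<Rightarrow> bool) \<Rightarrow> 'a \<Rightarrow> 'a \<Rightarrow> bool" where
  "lex_less c x y \<longleftrightarrow> (\<exists>k. agree c k x y \<and> \<not> c k x \<and> c k y)"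

definition lex_order :: "(nat \<Rightarrow> 'a \<Rightarrow> bool) \<Rightarrow> 'a set \<Rightarrow> 'a rel" where
  "lex_order c X = {(x, y) \<in> X \<times> X. x = y \<or> lex_less c x y}"

lemma agree_refl [simp]: "agree c k x x"
  by (simp add: agree_def)

lemma agree_sym: "agree c k x y \<Longrightarrow> agree c k y x"
  by (simp add: agree_def)

lemma agree_trans: "agree c k x y \<Longrightarrow> agree c k y z \<Longrightarrow> agree c k x z"
  by (simp add: agree_def)

lemma agree_0 [simp]: "agree c 0 x y"
  by (simp add: agree_def)

lemma agree_Suc: "agree c (Suc k) x y \<longleftrightarrow> agree c k x y \<and> c k x = c k y"
  by (auto simp: agree_def less_Suc_eq)

lemma agree_first_difference:
  assumes "\<not> agree c k x y"
  obtains j where "j < k" "agree c j x y" "c j x \<noteq> c j y"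
proof -
  define j where "j = (LEAST j. c j x \<noteq> c j y)"
  obtain i where i: "i < k" "c i x \<noteq> c i y"
    using assms by (auto simp: agree_def)
  have "c j x \<noteq> c j y" "j \<le> i"
    unfolding j_def using i(2) by (rule LeastI, rule Least_le)
  moreover have "agree c j x y"
    unfolding agree_def j_def using not_less_Least by blast
  ultimately show thesis
    using i(1) by (intro that[of j]) simp_all
qed

lemma lex_less_trans:
  assumes "lex_less c x y" "lex_less c y z"
  shows "lex_less c x z"
proof -
  obtain k l where k: "agree c k x y" "\<not> c k x" "c k y"
    and l: "agree c l y z" "\<not> c l y" "c l z"
    using assms by (auto simp: lex_less_def)
  consider "k < l" | "l < k"
    using k l by (metis nat_neq_iff)
  then show ?thesis
  proof cases
    case 1
    then have "agree c k x z \<and> \<not> c k x \<and> c k z"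
      using k l by (auto simp: agree_def)
    then show ?thesis by (auto simp: lex_less_def)
  next
    case 2
    then have "agree c l x z \<and> \<not> c l x \<and> c l z"
      using k l by (auto simp: agree_def)
    then show ?thesis by (auto simp: lex_less_def)
  qed
qed

lemma lex_less_irrefl: "\<not> lex_less c x x"
  by (simp add: lex_less_def)

lemma linear_order_on_lex_order:
  assumes sep: "\<And>x y. x \<in> X \<Longrightarrow> y \<in> X \<Longrightarrow> (\<And>k. c k x = c k y) \<Longrightarrow> x = y"
  shows "linear_order_on X (lex_order c X)"
proof -
  have "refl_on X (lex_order c X)"
    by (auto simp: refl_on_def lex_order_def)
  moreover have "lex_order c X \<subseteq> X \<times> X"
    by (auto simp: lex_order_def)
  moreover have "trans (lex_order c X)"
    unfolding trans_def lex_order_def by (auto intro: lex_less_trans)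
  moreover have "antisym (lex_order c X)"
    unfolding antisym_def lex_order_def using lex_less_trans lex_less_irrefl by fastforce
  moreover have "total_on X (lex_order c X)"
    unfolding total_on_def
  proof (intro ballI impI)
    fix x y assume xy: "x \<in> X" "y \<in> X" "x \<noteq> y"
    then obtain k where "\<not> agree c (Suc k) x y"
      using sep by (auto simp: agree_Suc)
    then obtain j where "agree c j x y" "c j x \<noteq> c j y"
      by (rule agree_first_difference)
    then show "(x, y) \<in> lex_order c X \<or> (y, x) \<in> lex_order c X"
      using xy unfolding lex_order_def lex_less_def by (auto dest: agree_sym)
  qed
  ultimately show ?thesis
    by (simp add: linear_order_on_def partial_order_on_def preorder_on_def)
qed

text \<open>If \<open>y\<close> left the common class of \<open>x\<close> and \<open>z\<close> at a
  first bit \<open>j\<close>, then \<open>x < y\<close> would force \<open>c j y\<close> to be true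
  and \<open>y < z\<close> would force it to be false. Hence level classes are intervals.\<close>

lemma lex_order_agree_convex:
  assumes "(x, y) \<in> lex_order c X" "(y, z) \<in> lex_order c X" "agree c k x z"
  shows "agree c k x y"
proof (rule ccontr)
  assume "\<not> agree c k x y"
  then obtain j where j: "j < k" "agree c j x y" "c j x \<noteq> c j y"
    by (rule agree_first_difference)
  have ne: "x \<noteq> y" "y \<noteq> z" using j assms(3) by (auto simp: agree_def)
  obtain l where l: "agree c l x y" "\<not> c l x" "c l y"
    using assms(1) ne by (auto simp: lex_order_def lex_less_def)
  obtain m where m: "agree c m y z" "\<not> c m y" "c m z"
    using assms(2) ne by (auto simp: lex_order_def lex_less_def)
  have "l = j"
    using j l by (metis agree_def nat_neq_iff)
  have zj: "agree c j y z" "c j y \<noteq> c j z"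
    using j assms(3) by (auto simp: agree_def)
  then have "m = j"
    using m by (metis agree_def nat_neq_iff)
  with \<open>l = j\<close> l m show False by simp
qed


section \<open>Divisions between consecutive levels\<close>

text \<open>An intermediate stage of merging level \<open>k + 1\<close> into level \<open>k\<close>:
  each part is the trace on \<open>A\<close> of a class of level \<open>k + 1\<close> or of a whole
  class of level \<open>k\<close>.\<close>

definition between_levels :: "(nat \<Rightarrow> 'a \<Rightarrow> bool) \<Rightarrow> 'a set \<Rightarrow> nat \<Rightarrow> 'a set set \<Rightarrow> bool" where
  "between_levels c A k P \<longleftrightarrow> partition_on A P \<and>
     (\<forall>I\<in>P. \<forall>x\<in>I. \<forall>y\<in>I. agree c k x y) \<and>
     (\<forall>I\<in>P. \<forall>x\<in>I. \<forall>y\<in>A. agree c (Suc k) x y \<longrightarrow> y \<in> I)"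

lemma between_levels_interval_partition:
  assumes P: "between_levels c A k P"
  shows "interval_partition A (lex_order c X) P"
proof -
  have "interval_in A (lex_order c X) I" if I: "I \<in> P" for I
    unfolding interval_in_def
  proof (intro conjI ballI impI)
    show "I \<subseteq> A"
      using P I by (auto simp: between_levels_def partition_on_def)
  next
    fix x z y assume xyz: "x \<in> I" "z \<in> I" "y \<in> A"
      and r: "(x, y) \<in> lex_order c X \<and> (y, z) \<in> lex_order c X"
    have xz: "agree c k x z"
      using P I xyz unfolding between_levels_def by blast
    then have xy: "agree c k x y"
      using r lex_order_agree_convex by metis
    have zy: "agree c k z y"
      using xy xz agree_sym agree_trans by metis
    \<comment> \<open>Bit \<open>k\<close> has only two values: if \<open>x\<close> and
      \<open>z\<close> differ there, \<open>y\<close> agrees with one of them; otherwise convexity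
      applies one level deeper.\<close>
    have "agree c (Suc k) x y \<or> agree c (Suc k) z y"
    proof (cases "c k x = c k z")
      case True
      then show ?thesis
        using xz r lex_order_agree_convex by (metis agree_Suc)
    next
      case False
      then show ?thesis
        using xy zy by (auto simp: agree_Suc)
    qed
    then show "y \<in> I"
      using P I xyz unfolding between_levels_def by blast
  qed
  then show ?thesis
    using P by (simp add: interval_partition_def between_levels_def)
qed

text \<open>The 1-entries in the rows of \<open>I\<close> all have their columns in one class of
  level \<open>k\<close>. Inside that class, distinct parts of \<open>Q\<close> are told apart by
  bit \<open>k\<close>, so at most two are met.\<close>

lemma between_levels_line_count:
  assumes P: "between_levels c A k P" and Q: "between_levels d B k Q"
    and I: "I \<in> P"
    and M: "\<And>x x' y y'. x \<in> A \<Longrightarrow> x' \<in> A \<Longrightarrow> y \<in> B \<Longrightarrow> y' \<in> B \<Longrightarrow> M x y \<Longrightarrow> M x' y' \<Longrightarrow>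
      agree c k x x' \<Longrightarrow> agree d k y y'"
  shows "card {J \<in> Q. quotient_entry M I J} \<le> 2"
proof -
  let ?S = "{J \<in> Q. quotient_entry M I J}"
  have "\<forall>J\<in>?S. \<exists>y. y \<in> J \<and> (\<exists>x\<in>I. M x y)"
    by (auto simp: quotient_entry_def)
  then obtain h where h: "\<And>J. J \<in> ?S \<Longrightarrow> h J \<in> J \<and> (\<exists>x\<in>I. M x (h J))"
    by metis
  have IA: "I \<subseteq> A" and JB: "\<And>J. J \<in> ?S \<Longrightarrow> J \<subseteq> B"
    using P Q I by (auto simp: between_levels_def partition_on_def)
  have "inj_on (\<lambda>J. d k (h J)) ?S"
  proof (rule inj_onI)
    fix J J' assume J: "J \<in> ?S" "J' \<in> ?S" and eq: "d k (h J) = d k (h J')"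
    obtain x x' where x: "x \<in> I" "M x (h J)" "x' \<in> I" "M x' (h J')"
      using h J by metis
    have "agree c k x x'"
      using P I x unfolding between_levels_def by blast
    moreover have "h J \<in> B" "h J' \<in> B"
      using h JB J by blast+
    ultimately have "agree d k (h J) (h J')"
      using M[of x x' "h J" "h J'"] x IA by blast
    then have "agree d (Suc k) (h J) (h J')"
      using eq by (simp add: agree_Suc)
    then have "h J' \<in> J"
      using Q J h \<open>h J' \<in> B\<close> unfolding between_levels_def by blast
    moreover have "h J' \<in> J'"
      using h J by blast
    ultimately show "J = J'"
      using Q J unfolding between_levels_def partition_on_def disjoint_def by blast
  qed
  then have "card ?S \<le> card (UNIV :: bool set)"
    by (rule card_inj_on_le) auto
  then show ?thesis by simp
qed

text \<open>The witnesses \<open>x\<close> and \<open>y\<close> place both parts in one class of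
  level \<open>k\<close>, so their union stays inside it.\<close>

lemma between_levels_merge:
  assumes P: "between_levels c A k P" and IJ: "I \<in> P" "J \<in> P" "I \<noteq> J"
    and xy: "x \<in> I" "y \<in> J" "agree c k x y"
  shows "between_levels c A k (insert (I \<union> J) (P - {I, J}))"
proof -
  have part: "partition_on A P"
    using P by (simp add: between_levels_def)
  have "partition_on A (insert (I \<union> J) (P - {I, J}))"
  proof (rule partition_onI)
    have "\<Union> (insert (I \<union> J) (P - {I, J})) = \<Union> P"
      using IJ by blast
    then show "\<Union> (insert (I \<union> J) (P - {I, J})) = A"
      using partition_onD1[OF part] by simp
    show "{} \<notin> insert (I \<union> J) (P - {I, J})"
      using xy(1) partition_onD3[OF part] by blast
    have dis: "disjnt p q" if "p \<in> P" "q \<in> P" "p \<noteq> q" for p q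
      using partition_onD2[OF part] that by (rule pairwiseD)
    have "disjnt (I \<union> J) q" if "q \<in> P - {I, J}" for q
      using dis[of I q] dis[of J q] that IJ by auto
    then show "disjnt p q" if "p \<in> insert (I \<union> J) (P - {I, J})"
      "q \<in> insert (I \<union> J) (P - {I, J})" "p \<noteq> q" for p q
      using that dis disjnt_sym by (metis Diff_iff insert_iff)
  qed
  moreover have "agree c k u v" if "u \<in> I \<union> J" "v \<in> I \<union> J" for u v
  proof -
    have "agree c k x w" if "w \<in> I \<union> J" for w
    proof (cases "w \<in> I")
      case True
      then show ?thesis
        using P IJ(1) xy(1) by (simp add: between_levels_def)
    next
      case False
      then have "agree c k y w"
        using P IJ(2) xy(2) that by (simp add: between_levels_def)
      then show ?thesis
        using xy(3) by (rule agree_trans[rotated])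
    qed
    then show ?thesis
      using that agree_sym agree_trans by metis
  qed
  moreover have "v \<in> K" if "K \<in> insert (I \<union> J) (P - {I, J})" "u \<in> K" "v \<in> A" "agree c (Suc k) u v" for K u v
  proof -
    have closed: "v \<in> L" if "L \<in> P" "u \<in> L" for L
      using P that \<open>v \<in> A\<close> \<open>agree c (Suc k) u v\<close> by (simp add: between_levels_def)
    show ?thesis
      using that(1,2) closed[of I] closed[of J] closed[of K] IJ(1,2) by auto
  qed
  moreover have "agree c k u v" if "K \<in> P" "u \<in> K" "v \<in> K" for K u v
    using P that by (simp add: between_levels_def)
  ultimately show ?thesis
    unfolding between_levels_def by (metis Diff_iff insert_iff)
qed

lemma between_levels_merges_to:
  assumes P: "between_levels c A k P" and fin: "finite A"
    and IJ: "I \<in> P" "J \<in> P" "I \<noteq> J" and xy: "x \<in> I" "y \<in> J" "agree c k x y"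
  obtains P' where "merges_to P P'" "between_levels c A k P'" "card P' < card P"
proof
  let ?P = "insert (I \<union> J) (P - {I, J})"
  show "merges_to P ?P"
    using IJ by (auto simp: merges_to_def)
  show "between_levels c A k ?P"
    using between_levels_merge assms by metis
  have "finite P"
    using P fin finite_elements by (auto simp: between_levels_def)
  have "card {I, J} \<le> card P"
    using \<open>finite P\<close> IJ by (intro card_mono) auto
  then have "card P = Suc (Suc (card (P - {I, J})))"
    using IJ by (simp add: card_Diff_subset)
  then show "card ?P < card P"
    using \<open>finite P\<close> by (simp add: card_insert_if)
qed

text \<open>If no class of level \<open>k + 1\<close> contains two parts, the parts are exactly the
  traces of these classes, which is the starting stage for level \<open>k\<close>. The descent
  changes how \<open>P\<close> is read, not \<open>P\<close> itself.\<close>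

lemma between_levels_pred:
  assumes P: "between_levels c A (Suc k) P"
    and no: "\<And>I J x y. I \<in> P \<Longrightarrow> J \<in> P \<Longrightarrow> x \<in> I \<Longrightarrow> y \<in> J \<Longrightarrow> agree c (Suc k) x y \<Longrightarrow> I = J"
  shows "between_levels c A k P"
  unfolding between_levels_def
proof (intro conjI ballI impI)
  show "partition_on A P"
    using P by (simp add: between_levels_def)
  show "agree c k x y" if "I \<in> P" "x \<in> I" "y \<in> I" for I x y
    using P that agree_Suc unfolding between_levels_def by metis
  show "y \<in> I" if "I \<in> P" "x \<in> I" "y \<in> A" "agree c (Suc k) x y" for I x y
  proof -
    obtain J where "J \<in> P" "y \<in> J"
      using P \<open>y \<in> A\<close> by (auto simp: between_levels_def partition_on_def)
    then show ?thesis using no that by blast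
  qed
qed

lemma between_levels_0_full:
  assumes P: "between_levels c A 0 P" and "A \<noteq> {}"
    and no: "\<And>I J x y. I \<in> P \<Longrightarrow> J \<in> P \<Longrightarrow> x \<in> I \<Longrightarrow> y \<in> J \<Longrightarrow> agree c 0 x y \<Longrightarrow> I = J"
  shows "P = {A}"
proof -
  have part: "partition_on A P"
    using P by (simp add: between_levels_def)
  obtain x where "x \<in> A"
    using \<open>A \<noteq> {}\<close> by blast
  then obtain I where I: "I \<in> P" "x \<in> I"
    using partition_onD1[OF part] by blast
  have "J = I" if J: "J \<in> P" for J
  proof -
    obtain y where "y \<in> J"
      using partition_onD3[OF part] J by fastforce
    then show ?thesis
      using no[OF J I(1) _ I(2)] by simp
  qed
  then have "P = {I}"
    using I(1) by blast
  then show ?thesis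
    using partition_onD1[OF part] by simp
qed

lemma between_levels_singletons:
  assumes "\<And>x y. x \<in> A \<Longrightarrow> y \<in> A \<Longrightarrow> agree c (Suc k) x y \<Longrightarrow> x = y"
  shows "between_levels c A k ((\<lambda>x. {x}) ` A)"
  using assms by (auto simp: between_levels_def partition_on_def disjoint_def)

lemma agree_separates_finite:
  assumes "finite A" and sep: "\<And>x y. x \<in> A \<Longrightarrow> y \<in> A \<Longrightarrow> (\<And>k. c k x = c k y) \<Longrightarrow> x = y"
  obtains K where "\<And>k x y. K \<le> k \<Longrightarrow> x \<in> A \<Longrightarrow> y \<in> A \<Longrightarrow> agree c k x y \<Longrightarrow> x = y"
proof -
  have "\<forall>p. \<exists>k. p \<in> A \<times> A \<and> fst p \<noteq> snd p \<longrightarrow> c k (fst p) \<noteq> c k (snd p)"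
    using sep by (metis mem_Times_iff)
  then obtain d where d: "\<And>p. p \<in> A \<times> A \<Longrightarrow> fst p \<noteq> snd p \<Longrightarrow> c (d p) (fst p) \<noteq> c (d p) (snd p)"
    by metis
  \<comment> \<open>\<open>d\<close> picks a separating bit for each pair of distinct points; the
    successor is there because \<open>agree c k\<close> inspects only the bits below
    \<open>k\<close>.\<close>
  define K where "K = Suc (Max (d ` (A \<times> A)))"
  have "d p < K" if "p \<in> A \<times> A" for p
    using that \<open>finite A\<close> by (auto simp: K_def less_Suc_eq_le intro!: Max_ge)
  then show thesis
    using d by (intro that[of K]) (metis agree_def fst_conv snd_conv mem_Sigma_iff order_less_le_trans)
qed


section \<open>Strict twin-width of level-preserving matrices\<close>

lemma finite_line_counts:
  assumes "finite (fst D)" "finite (snd D)"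
  shows "finite (line_counts M D)"
  using assms by (simp add: line_counts_def)

lemma is_division_finite:
  assumes "is_division A r B s D" "finite A" "finite B"
  shows "finite (fst D)" "finite (snd D)"
  using assms finite_elements by (auto simp: is_division_def interval_partition_def)

lemma width_le:
  assumes Ds: "division_sequence A r B s Ds" and fin: "finite A" "finite B"
    and le: "\<And>D n. D \<in> set Ds \<Longrightarrow> n \<in> line_counts M D \<Longrightarrow> n \<le> w"
  shows "width M Ds \<le> w"
proof -
  have div: "is_division A r B s D" if "D \<in> set Ds" for D
    using Ds that by (auto simp: division_sequence_def)
  \<comment> \<open>\<open>Max\<close> is meaningful only on a nonempty set; the lines of the final
    division supply an element.\<close>
  have "({A}, {B}) \<in> set Ds"
    using Ds by (metis division_sequence_def last_in_set)
  then have "(\<Union>D\<in>set Ds. line_counts M D) \<noteq> {}"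
    by (force simp: line_counts_def)
  moreover have "finite (\<Union>D\<in>set Ds. line_counts M D)"
    using div fin by (auto intro!: finite_line_counts is_division_finite)
  ultimately show ?thesis
    unfolding width_def using le by (subst Max_le_iff) auto
qed

lemma width_ge:
  assumes Ds: "division_sequence A r B s Ds" and fin: "finite A" "finite B"
    and "D \<in> set Ds" "n \<in> line_counts M D"
  shows "n \<le> width M Ds"
proof -
  have "is_division A r B s D" if "D \<in> set Ds" for D
    using Ds that by (auto simp: division_sequence_def)
  then have "finite (\<Union>D\<in>set Ds. line_counts M D)"
    using fin by (auto intro!: finite_line_counts is_division_finite)
  then show ?thesis
    unfolding width_def using assms by (intro Max_ge) auto
qed

section \<open>Building division sequences of bounded width\<close>

definition narrow_division ::
  "'a set \<Rightarrow> 'a rel \<Rightarrow> 'b set \<Rightarrow> 'b rel \<Rightarrow> ('a \<Rightarrow> 'b \<Rightarrow> bool) \<Rightarrow> nat \<Rightarrow> ('a, 'b) division \<Rightarrow> bool" where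
  "narrow_division A r B s M w D \<longleftrightarrow> is_division A r B s D \<and> (\<forall>n\<in>line_counts M D. n \<le> w)"

text \<open>Sequences are built backwards from the final division and may start at any
  \<open>D\<close>, so that induction can prepend one step without handling list indices.\<close>

inductive narrow_reach ::
  "'a set \<Rightarrow> 'a rel \<Rightarrow> 'b set \<Rightarrow> 'b rel \<Rightarrow> ('a \<Rightarrow> 'b \<Rightarrow> bool) \<Rightarrow> nat \<Rightarrow> ('a, 'b) division \<Rightarrow> bool"
  for A r B s M w where
  final: "narrow_division A r B s M w ({A}, {B}) \<Longrightarrow> narrow_reach A r B s M w ({A}, {B})"
| step: "narrow_division A r B s M w D \<Longrightarrow> division_step D D' \<Longrightarrow> narrow_reach A r B s M w D' \<Longrightarrow>
    narrow_reach A r B s M w D"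

lemma narrow_reach_list:
  assumes "narrow_reach A r B s M w D"
  shows "\<exists>Ds. Ds \<noteq> [] \<and> hd Ds = D \<and> last Ds = ({A}, {B}) \<and>
    (\<forall>D\<in>set Ds. narrow_division A r B s M w D) \<and>
    (\<forall>i. Suc i < length Ds \<longrightarrow> division_step (Ds ! i) (Ds ! Suc i))"
  using assms
proof induction
  case final
  then show ?case by (intro exI[of _ "[({A}, {B})]"]) simp
next
  case (step D D')
  then obtain Ds where Ds: "Ds \<noteq> []" "hd Ds = D'" "last Ds = ({A}, {B})"
    "\<forall>D\<in>set Ds. narrow_division A r B s M w D"
    "\<forall>i. Suc i < length Ds \<longrightarrow> division_step (Ds ! i) (Ds ! Suc i)"
    by blast
  have "division_step ((D # Ds) ! i) ((D # Ds) ! Suc i)" if "Suc i < length (D # Ds)" for i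
    using that Ds step.hyps by (cases i) (auto simp: hd_conv_nth)
  then show ?case
    using Ds step.hyps by (intro exI[of _ "D # Ds"]) simp
qed

lemma stww_finite_le_if_narrow_reach:
  assumes "narrow_reach A r B s M w ((\<lambda>x. {x}) ` A, (\<lambda>y. {y}) ` B)" "finite A" "finite B"
  shows "stww_finite A r B s M \<le> enat w"
proof -
  obtain Ds where Ds: "Ds \<noteq> []" "hd Ds = ((\<lambda>x. {x}) ` A, (\<lambda>y. {y}) ` B)"
    "last Ds = ({A}, {B})" "\<forall>D\<in>set Ds. narrow_division A r B s M w D"
    "\<forall>i. Suc i < length Ds \<longrightarrow> division_step (Ds ! i) (Ds ! Suc i)"
    using narrow_reach_list[OF assms(1)] by blast
  then have seq: "division_sequence A r B s Ds"
    by (simp add: division_sequence_def narrow_division_def)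
  have "width M Ds \<le> w"
    using width_le[OF seq assms(2,3)] Ds(4) by (auto simp: narrow_division_def)
  then show ?thesis
    unfolding stww_finite_def using seq by (intro INF_lower2[of Ds]) auto
qed

text \<open>On either side, parts lying in one class of level \<open>k\<close> are merged as long as
  possible; then both sides descend to the next coarser level together. Rows and columns thus stay
  at the same level, as the line counts require.\<close>

lemma narrow_reach_between_levels:
  assumes fin: "finite A" "finite B" and ne: "A \<noteq> {}" "B \<noteq> {}"
    and M: "\<And>k x x' y y'. x \<in> A \<Longrightarrow> x' \<in> A \<Longrightarrow> y \<in> B \<Longrightarrow> y' \<in> B \<Longrightarrow> M x y \<Longrightarrow> M x' y' \<Longrightarrow>
      agree c k x x' \<longleftrightarrow> agree d k y y'"
    and "between_levels c A k P" "between_levels d B k Q"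
  shows "narrow_reach A (lex_order c X) B (lex_order d Y) M 2 (P, Q)"
  using assms(6,7)
\<comment> \<open>A merge lowers a cardinality, a descent lowers \<open>k\<close>.\<close>
proof (induction "k + card P + card Q" arbitrary: k P Q rule: less_induct)
  case less
  note P = less.prems(1) and Q = less.prems(2)
  have row: "card {J \<in> Q. quotient_entry M I J} \<le> 2" if "I \<in> P" for I
    using between_levels_line_count[OF P Q that, of M] M by blast
  have col: "card {I \<in> P. quotient_entry M I J} \<le> 2" if "J \<in> Q" for J
  proof -
    \<comment> \<open>Columns are rows of the transposed matrix, and the hypothesis on
      \<open>M\<close> is symmetric under transposition.\<close>
    have "{I \<in> P. quotient_entry M I J} = {I \<in> P. quotient_entry (\<lambda>y x. M x y) J I}"
      by (auto simp: quotient_entry_def)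
    then show ?thesis
      using between_levels_line_count[OF Q P that, of "\<lambda>y x. M x y"] M by auto
  qed
  have narrow: "narrow_division A (lex_order c X) B (lex_order d Y) M 2 (P, Q)"
    using row col between_levels_interval_partition[OF P] between_levels_interval_partition[OF Q]
    by (auto simp: narrow_division_def is_division_def line_counts_def)
  consider (P) I J x y where "I \<in> P" "J \<in> P" "I \<noteq> J" "x \<in> I" "y \<in> J" "agree c k x y"
    | (Q) I J x y where "I \<in> Q" "J \<in> Q" "I \<noteq> J" "x \<in> I" "y \<in> J" "agree d k x y"
    | (full) "\<And>I J x y. I \<in> P \<Longrightarrow> J \<in> P \<Longrightarrow> x \<in> I \<Longrightarrow> y \<in> J \<Longrightarrow> agree c k x y \<Longrightarrow> I = J"
      "\<And>I J x y. I \<in> Q \<Longrightarrow> J \<in> Q \<Longrightarrow> x \<in> I \<Longrightarrow> y \<in> J \<Longrightarrow> agree d k x y \<Longrightarrow> I = J"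
    by blast
  then show ?case
  proof cases
    case P
    obtain P' where P': "merges_to P P'" "between_levels c A k P'" "card P' < card P"
      using between_levels_merges_to[OF less.prems(1) fin(1) P] by blast
    have "narrow_reach A (lex_order c X) B (lex_order d Y) M 2 (P', Q)"
      using less.hyps[OF _ P'(2) Q] P'(3) by simp
    then show ?thesis
      using narrow P'(1) by (auto simp: division_step_def intro: narrow_reach.step[OF _ _ \<open>narrow_reach _ _ _ _ _ _ (P', Q)\<close>])
  next
    case Q
    obtain Q' where Q': "merges_to Q Q'" "between_levels d B k Q'" "card Q' < card Q"
      using between_levels_merges_to[OF less.prems(2) fin(2) Q] by blast
    have "narrow_reach A (lex_order c X) B (lex_order d Y) M 2 (P, Q')"
      using less.hyps[OF _ P Q'(2)] Q'(3) by simp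
    then show ?thesis
      using narrow Q'(1) by (auto simp: division_step_def intro: narrow_reach.step[OF _ _ \<open>narrow_reach _ _ _ _ _ _ (P, Q')\<close>])
  next
    case full
    show ?thesis
    proof (cases k)
      case 0
      have "P = {A}"
        using P ne(1) full(1) unfolding 0 by (rule between_levels_0_full) simp_all
      moreover have "Q = {B}"
        using Q ne(2) full(2) unfolding 0 by (rule between_levels_0_full) simp_all
      ultimately show ?thesis
        using narrow narrow_reach.final by metis
    next
      case (Suc l)
      have "between_levels c A l P"
        using between_levels_pred[of c A l P] P full(1) Suc by blast
      moreover have "between_levels d B l Q"
        using between_levels_pred[of d B l Q] Q full(2) Suc by blast
      ultimately show ?thesis
        using less.hyps[of l P Q] Suc by simp
    qed
  qed
qed

lemma stww_finite_lex_order_le: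
  assumes fin: "finite A" "finite B" and ne: "A \<noteq> {}" "B \<noteq> {}" and sub: "A \<subseteq> X" "B \<subseteq> X"
    and sep: "\<And>x y. x \<in> X \<Longrightarrow> y \<in> X \<Longrightarrow> (\<And>k. c k x = c k y) \<Longrightarrow> x = y"
    and M: "\<And>k x x' y y'. x \<in> X \<Longrightarrow> x' \<in> X \<Longrightarrow> y \<in> X \<Longrightarrow> y' \<in> X \<Longrightarrow> M x y \<Longrightarrow> M x' y' \<Longrightarrow>
      agree c k x x' \<longleftrightarrow> agree c k y y'"
  shows "stww_finite A (lex_order c X) B (lex_order c X) M \<le> 2"
proof -
  \<comment> \<open>A single bound for \<open>A \<union> B\<close> lets rows and columns start at
    the same level.\<close>
  obtain K where K: "\<And>k x y. K \<le> k \<Longrightarrow> x \<in> A \<union> B \<Longrightarrow> y \<in> A \<union> B \<Longrightarrow> agree c k x y \<Longrightarrow> x = y"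
    using agree_separates_finite[of "A \<union> B" c] fin sub sep by (metis Un_least finite_UnI subsetD)
  have "between_levels c A K ((\<lambda>x. {x}) ` A)" "between_levels c B K ((\<lambda>x. {x}) ` B)"
    using K[of "Suc K"] by (auto intro!: between_levels_singletons)
  then have "narrow_reach A (lex_order c X) B (lex_order c X) M 2 ((\<lambda>x. {x}) ` A, (\<lambda>x. {x}) ` B)"
    using M sub by (intro narrow_reach_between_levels fin ne) blast+
  then show ?thesis
    using stww_finite_le_if_narrow_reach[OF _ fin] by (simp add: numeral_eq_enat)
qed

lemma stww_lex_order_le:
  assumes ne: "X \<noteq> {}"
    and sep: "\<And>x y. x \<in> X \<Longrightarrow> y \<in> X \<Longrightarrow> (\<And>k. c k x = c k y) \<Longrightarrow> x = y"
    and M: "\<And>k x x' y y'. x \<in> X \<Longrightarrow> x' \<in> X \<Longrightarrow> y \<in> X \<Longrightarrow> y' \<in> X \<Longrightarrow> M x y \<Longrightarrow> M x' y' \<Longrightarrow>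
      agree c k x x' \<longleftrightarrow> agree c k y y'"
  shows "stww X (lex_order c X) X (lex_order c X) M \<le> 2"
proof -
  have "stww_finite A (lex_order c X) B (lex_order c X) M \<le> 2"
    if "A \<subseteq> X" "finite A" "A \<noteq> {}" "B \<subseteq> X" "finite B" "B \<noteq> {}" for A B
    by (rule stww_finite_lex_order_le) (fact that sep M)+
  then show ?thesis
    unfolding stww_def using ne by (auto intro!: SUP_least)
qed


section \<open>The lower bound\<close>

text \<open>For an identity matrix a quotient entry means that the two parts intersect, so this
  counts the entries on the merged line.\<close>

lemma merges_to_singletons_count:
  assumes "merges_to ((\<lambda>x. {x}) ` A) P'"
  obtains I where "I \<in> P'" "card {J \<in> (\<lambda>x. {x}) ` A. I \<inter> J \<noteq> {}} = 2"
proof -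
  obtain x y where xy: "x \<in> A" "y \<in> A" "x \<noteq> y"
    and P': "P' = insert ({x} \<union> {y}) ((\<lambda>x. {x}) ` A - {{x}, {y}})"
    using assms unfolding merges_to_def by blast
  have "{J \<in> (\<lambda>x. {x}) ` A. {x, y} \<inter> J \<noteq> {}} = {{x}, {y}}"
    using xy by auto
  then show thesis
    using xy P' by (intro that[of "{x, y}"]) auto
qed

lemma stww_finite_identity_ge:
  assumes fin: "finite A" and xy: "x \<in> A" "y \<in> A" "x \<noteq> y"
    and M: "\<And>u v. u \<in> A \<Longrightarrow> v \<in> A \<Longrightarrow> M u v \<longleftrightarrow> u = v"
  shows "2 \<le> stww_finite A r A s M"
  unfolding stww_finite_def
proof (rule INF_greatest)
  fix Ds assume "Ds \<in> {Ds. division_sequence A r A s Ds}"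
  then have Ds: "division_sequence A r A s Ds" by simp
  let ?S = "(\<lambda>x. {x}) ` A"
  have hd: "Ds \<noteq> []" "hd Ds = (?S, ?S)" "last Ds = ({A}, {A})"
    using Ds by (auto simp: division_sequence_def)
  \<comment> \<open>\<open>A\<close> has two points, so the sequence does not end where it starts
    and has a second division, the result of the first merge.\<close>
  have "?S \<noteq> {A}"
    using xy by (metis image_eqI singletonD singletonI)
  then have "hd Ds \<noteq> last Ds"
    using hd by simp
  then have len: "Suc 0 < length Ds"
    using hd(1) by (cases Ds; cases "tl Ds") auto
  define D where "D = Ds ! Suc 0"
  have D: "D \<in> set Ds"
    using len by (simp add: D_def)
  have "division_step (Ds ! 0) D"
    using Ds len by (auto simp: division_sequence_def D_def)
  then have "division_step (?S, ?S) D"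
    using hd by (simp add: hd_conv_nth)
  moreover have sub: "\<Union> (fst D) = A" "\<Union> (snd D) = A"
    using Ds D by (auto simp: division_sequence_def is_division_def interval_partition_def partition_on_def)
  have entry: "quotient_entry M I J \<longleftrightarrow> I \<inter> J \<noteq> {}" if "I \<subseteq> A" "J \<subseteq> A" for I J
    using that M unfolding quotient_entry_def by blast
  ultimately consider "merges_to ?S (fst D)" "snd D = ?S" | "fst D = ?S" "merges_to ?S (snd D)"
    by (auto simp: division_step_def)
  then have "2 \<in> line_counts M D"
  proof cases
    case 1
    obtain I where I: "I \<in> fst D" "card {J \<in> ?S. I \<inter> J \<noteq> {}} = 2"
      using 1(1) by (rule merges_to_singletons_count)
    have "I \<subseteq> A"
      using I sub by blast
    then have "{J \<in> snd D. quotient_entry M I J} = {J \<in> ?S. I \<inter> J \<noteq> {}}"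
      unfolding 1(2) using entry by (intro Collect_cong) auto
    then have "card {J \<in> snd D. quotient_entry M I J} = 2"
      using I(2) by simp
    then show ?thesis
      using I(1) unfolding line_counts_def by (intro UnI1 image_eqI[where x = I]) simp_all
  next
    case 2
    obtain J where J: "J \<in> snd D" "card {I \<in> ?S. J \<inter> I \<noteq> {}} = 2"
      using 2(2) by (rule merges_to_singletons_count)
    have "J \<subseteq> A"
      using J sub by blast
    then have "{I \<in> fst D. quotient_entry M I J} = {I \<in> ?S. J \<inter> I \<noteq> {}}"
      unfolding 2(1) using entry by (intro Collect_cong) (auto simp: Int_commute)
    then have "card {I \<in> fst D. quotient_entry M I J} = 2"
      using J(2) by simp
    then show ?thesis
      using J(1) unfolding line_counts_def by (intro UnI2 image_eqI[where x = J]) simp_all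
  qed
  then have "2 \<le> width M Ds"
    using width_ge Ds fin D by metis
  then show "2 \<le> enat (width M Ds)"
    by (simp add: numeral_eq_enat)
qed

lemma stww_identity_ge:
  assumes xy: "x \<in> X" "y \<in> X" "x \<noteq> y"
    and M: "\<And>u v. u \<in> X \<Longrightarrow> v \<in> X \<Longrightarrow> M u v \<longleftrightarrow> u = v"
  shows "2 \<le> stww X r X s M"
proof (cases "finite X")
  case True
  then show ?thesis
    using stww_finite_identity_ge[OF True xy] M by (simp add: stww_def)
next
  case False
  \<comment> \<open>The two-by-two identity submatrix bounds the supremum from below.\<close>
  have "2 \<le> stww_finite {x, y} r {x, y} s M"
    using xy M by (intro stww_finite_identity_ge[of _ x y]) auto
  then show ?thesis
    unfolding stww_def using False xy by (auto intro!: SUP_upper2[of "({x, y}, {x, y})"])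
qed

text \<open>Multiplication by the unit gives the identity matrix, whatever the order on the
  group.\<close>

lemma utww_ge:
  assumes G: "group G" and x: "x \<in> carrier G" "x \<noteq> \<one>\<^bsub>G\<^esub>"
  shows "2 \<le> utww G"
proof -
  interpret group G by fact
  have "2 \<le> (SUP g \<in> carrier G. stww (carrier G) r (carrier G) r (mult_matrix G g))" for r
    using x by (intro SUP_upper2[of "\<one>\<^bsub>G\<^esub>"] stww_identity_ge[of x _ "\<one>\<^bsub>G\<^esub>"]) (auto simp: mult_matrix_def)
  then show ?thesis
    unfolding utww_def by (intro INF_greatest)
qed

lemma utww_le:
  assumes G: "group G"
    and sep: "\<And>x y. x \<in> carrier G \<Longrightarrow> y \<in> carrier G \<Longrightarrow> (\<And>k. c k x = c k y) \<Longrightarrow> x = y"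
    and inv: "\<And>k x y g. x \<in> carrier G \<Longrightarrow> y \<in> carrier G \<Longrightarrow> g \<in> carrier G \<Longrightarrow>
      agree c k x y \<Longrightarrow> agree c k (x \<otimes>\<^bsub>G\<^esub> g) (y \<otimes>\<^bsub>G\<^esub> g)"
  shows "utww G \<le> 2"
proof -
  interpret group G by fact
  let ?r = "lex_order c (carrier G)"
  have "stww (carrier G) ?r (carrier G) ?r (mult_matrix G g) \<le> 2" if g: "g \<in> carrier G" for g
  proof (rule stww_lex_order_le[OF _ sep])
    fix k x x' y y' assume x: "x \<in> carrier G" "x' \<in> carrier G"
      and "mult_matrix G g x y" "mult_matrix G g x' y'"
    then have y: "y = x \<otimes>\<^bsub>G\<^esub> g" "y' = x' \<otimes>\<^bsub>G\<^esub> g"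
      by (auto simp: mult_matrix_def)
    \<comment> \<open>Multiplying back by the inverse of \<open>g\<close> yields the converse of the
      implication in \<open>inv\<close>.\<close>
    have "y \<otimes>\<^bsub>G\<^esub> inv\<^bsub>G\<^esub> g = x" "y' \<otimes>\<^bsub>G\<^esub> inv\<^bsub>G\<^esub> g = x'"
      using x g by (simp_all add: y m_assoc)
    then show "agree c k x x' \<longleftrightarrow> agree c k y y'"
      using inv[OF x g, of k] inv[of y y' "inv\<^bsub>G\<^esub> g" k] x g by (auto simp: y)
  qed auto
  then have "(SUP g \<in> carrier G. stww (carrier G) ?r (carrier G) ?r (mult_matrix G g)) \<le> 2"
    by (rule SUP_least)
  then show ?thesis
    unfolding utww_def using linear_order_on_lex_order[of "carrier G" c] sep
    by (intro INF_lower2[of ?r]) auto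
qed


section \<open>Portraits of tree automorphisms\<close>

text \<open>The most recent choice comes first, so the head tells on which side of its parent the
  image of the left child lies. For an automorphism it is true iff the children of \<open>u\<close>
  are swapped.\<close>

definition portrait :: "(node \<Rightarrow> node) \<Rightarrow> node \<Rightarrow> bool" where
  "portrait f u = hd (f (False # u))"

text \<open>The two siblings go to distinct children of \<open>f u\<close>, so one bit determines
  both images.\<close>

lemma tree_automorphism_Cons:
  assumes f: "tree_automorphism f"
  shows "f (b # u) = (b \<noteq> portrait f u) # f u"
proof -
  have child: "\<exists>b'. f (b # u) = b' # f u" for b
    using f unfolding tree_automorphism_def parent_of_def by blast
  have F: "f (False # u) = portrait f u # f u"
    using child[of False] by (auto simp: portrait_def)
  have "f (True # u) \<noteq> f (False # u)"
    using f unfolding tree_automorphism_def by (metis bij_is_inj injD list.inject)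
  then have "f (True # u) = (\<not> portrait f u) # f u"
    using child[of True] F by (metis (full_types))
  with F show ?thesis by (cases b) auto
qed

lemma tree_automorphism_length:
  assumes "tree_automorphism f"
  shows "length (f u) = length u"
  using assms
  by (induction u) (auto simp: tree_automorphism_Cons, simp add: tree_automorphism_def)

text \<open>\<open>g\<close> acts first, so \<open>f\<close> contributes its swap at
  \<open>g u\<close>, and the two swaps add in GF(2).\<close>

lemma portrait_comp:
  assumes "tree_automorphism f" "tree_automorphism g"
  shows "portrait (f \<circ> g) u = (portrait g u \<noteq> portrait f (g u))"
  using assms by (simp add: portrait_def[of "f \<circ> g"] tree_automorphism_Cons)

lemma portrait_inject:
  assumes "tree_automorphism f" "tree_automorphism g" "portrait f = portrait g"
  shows "f = g"
proof
  show "f u = g u" for u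
    using assms by (induction u) (auto simp: tree_automorphism_Cons, simp add: tree_automorphism_def)
qed


section \<open>An invariant flag of functionals on each level\<close>

text \<open>
  The functionals \<open>v \<mapsto> level_functional n i v\<close> for \<open>i < 2 ^ n\<close> form a basis of the dual of the
  space of \<open>GF(2)\<close>-valued functions on level \<open>n\<close>, addition being \<open>\<noteq>\<close>. The first half of them
  only sees the sums over sibling pairs; modulo these, the second half does not depend on the
  choice of one sibling from each pair.
\<close>

fun level_functional :: "nat \<Rightarrow> nat \<Rightarrow> (node \<Rightarrow> bool) \<Rightarrow> bool" where
  "level_functional 0 i v = v []"
| "level_functional (Suc n) i v =
     (if i < 2 ^ n then level_functional n i (\<lambda>u. v (False # u) \<noteq> v (True # u))
      else level_functional n (i - 2 ^ n) (\<lambda>u. v (True # u)))"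

lemma level_functional_cong:
  assumes "\<And>u. length u = n \<Longrightarrow> v u = w u"
  shows "level_functional n i v = level_functional n i w"
  using assms
proof (induction n arbitrary: i v w)
  case (Suc n)
  show ?case
    using Suc.prems by (auto intro!: Suc.IH)
qed simp

lemma level_functional_add:
  "level_functional n i (\<lambda>u. v u \<noteq> w u) = (level_functional n i v \<noteq> level_functional n i w)"
proof (induction n arbitrary: i v w)
  case (Suc n)
  have "(\<lambda>u. (v (False # u) \<noteq> w (False # u)) \<noteq> (v (True # u) \<noteq> w (True # u))) =
        (\<lambda>u. (v (False # u) \<noteq> v (True # u)) \<noteq> (w (False # u) \<noteq> w (True # u)))"
    by auto
  then show ?case
    using Suc.IH[of i "\<lambda>u. v (False # u) \<noteq> v (True # u)" "\<lambda>u. w (False # u) \<noteq> w (True # u)"]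
      Suc.IH[of "i - 2 ^ n" "\<lambda>u. v (True # u)" "\<lambda>u. w (True # u)"]
    by (simp only: level_functional.simps split: if_split) blast
qed simp

text \<open>By induction, the first half of the functionals forces siblings to have equal values,
  and the second half forces the value at every right sibling to vanish.\<close>

lemma level_functional_separates:
  assumes "\<And>i. i < 2 ^ n \<Longrightarrow> \<not> level_functional n i v" "length u = n"
  shows "\<not> v u"
  using assms
proof (induction n arbitrary: u v)
  case (Suc n)
  obtain b w where u: "u = b # w" "length w = n"
    using Suc.prems(2) by (cases u) auto
  have "\<not> level_functional n i (\<lambda>u. v (False # u) \<noteq> v (True # u))" if "i < 2 ^ n" for i
    using Suc.prems(1)[of i] that by simp
  then have "v (False # w) = v (True # w)"
    using Suc.IH[of "\<lambda>u. v (False # u) \<noteq> v (True # u)" w] u by blast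
  moreover have "\<not> level_functional n i (\<lambda>u. v (True # u))" if "i < 2 ^ n" for i
    using Suc.prems(1)[of "2 ^ n + i"] that by simp
  then have "\<not> v (True # w)"
    using Suc.IH[of "\<lambda>u. v (True # u)" w] u by blast
  ultimately show ?case
    using u by (cases b) auto
qed (use assms in auto)

text \<open>This is the stability of the flag under \<open>g\<close>. Swapping siblings keeps their
  sum, which settles the first half of the indices. In the second half all sibling sums already
  vanish, so \<open>v\<close> is constant on sibling pairs and restriction to right siblings
  commutes with \<open>g\<close>.\<close>

lemma level_functional_invariant:
  assumes g: "tree_automorphism g" and "i < 2 ^ n" "\<And>j. j \<le> i \<Longrightarrow> \<not> level_functional n j v"
  shows "\<not> level_functional n i (v \<circ> g)"
  using assms(2,3)
proof (induction n arbitrary: i v)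
  case 0
  then show ?case
    using g by (auto simp: tree_automorphism_def)
next
  case (Suc n)
  let ?s = "\<lambda>u. v (False # u) \<noteq> v (True # u)"
  show ?case
  proof (cases "i < 2 ^ n")
    case True
    have "((v \<circ> g) (False # u) \<noteq> (v \<circ> g) (True # u)) = (?s \<circ> g) u" for u
      using g by (cases "portrait g u") (auto simp: tree_automorphism_Cons)
    then have eq: "(\<lambda>u. (v \<circ> g) (False # u) \<noteq> (v \<circ> g) (True # u)) = ?s \<circ> g"
      by blast
    have "\<not> level_functional n j ?s" if "j \<le> i" for j
      using Suc.prems(2)[OF that] that True by simp
    then have "\<not> level_functional n i (?s \<circ> g)"
      by (rule Suc.IH[OF True])
    then show ?thesis
      using True unfolding level_functional.simps eq by simp
  next
    case False
    \<comment> \<open>Here \<open>i\<close> lies in the second half, so every functional of the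
      first half precedes it and vanishes on \<open>v\<close>.\<close>
    have "\<not> level_functional n j ?s" if "j < 2 ^ n" for j
      using Suc.prems(2)[of j] that False by simp
    then have s: "v (False # u) = v (True # u)" if "length u = n" for u
      using level_functional_separates[of n ?s u] that by blast
    have "(v \<circ> g) (True # u) = ((\<lambda>u. v (True # u)) \<circ> g) u" if "length u = n" for u
      using s[of "g u"] that g
      by (cases "portrait g u") (simp_all add: tree_automorphism_Cons tree_automorphism_length)
    \<comment> \<open>The two functions are known to coincide only on level \<open>n\<close>, hence
      the congruence rule.\<close>
    then have eq: "level_functional n (i - 2 ^ n) (\<lambda>u. (v \<circ> g) (True # u)) =
        level_functional n (i - 2 ^ n) ((\<lambda>u. v (True # u)) \<circ> g)"
      by (rule level_functional_cong)
    have "\<not> level_functional n j (\<lambda>u. v (True # u))" if "j \<le> i - 2 ^ n" for j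
      using Suc.prems(2)[of "2 ^ n + j"] that False by simp
    then have "\<not> level_functional n (i - 2 ^ n) ((\<lambda>u. v (True # u)) \<circ> g)"
      using Suc.prems(1) False by (intro Suc.IH) simp_all
    then show ?thesis
      using False unfolding level_functional.simps eq by simp
  qed
qed

text \<open>
  The pair \<open>(n, i)\<close> with \<open>i < 2 ^ n\<close> has position \<open>2 ^ n + i\<close>; position \<open>0\<close> repeats position \<open>1\<close>.
\<close>

definition functional :: "nat \<Rightarrow> (node \<Rightarrow> bool) \<Rightarrow> bool" where
  "functional m v = level_functional (floor_log m) (m - 2 ^ floor_log m) v"

lemma functional_position:
  assumes "i < 2 ^ n"
  shows "functional (2 ^ n + i) v = level_functional n i v"
proof -
  have "floor_log (2 ^ n + i) = n"
    using assms by (intro floor_log_eqI) auto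
  then show ?thesis
    by (simp add: functional_def)
qed

lemma position_cases:
  fixes m :: nat
  obtains "m = 0" | n i where "m = 2 ^ n + i" "i < 2 ^ n"
proof (cases "m = 0")
  case False
  have "2 ^ floor_log m \<le> m" "m < 2 * 2 ^ floor_log m"
    using False floor_log_exp2_le[of m] floor_log_exp2_gt[of m] by auto
  then show ?thesis
    using that(2)[of "floor_log m" "m - 2 ^ floor_log m"] by simp
qed (use that in blast)

lemma functional_add: "functional m (\<lambda>u. v u \<noteq> w u) = (functional m v \<noteq> functional m w)"
  by (simp only: functional_def level_functional_add)

lemma functional_separates:
  assumes "\<And>m. \<not> functional m v"
  shows "\<not> v u"
  using level_functional_separates[of "length u" v u] assms functional_position by metis

lemma functional_invariant:
  assumes g: "tree_automorphism g" and v: "\<And>j. j \<le> m \<Longrightarrow> \<not> functional j v"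
  shows "\<not> functional m (v \<circ> g)"
proof (cases m rule: position_cases)
  case 1
  \<comment> \<open>\<open>floor_log 0\<close> is \<open>0\<close>, so position \<open>0\<close>
    evaluates at the root, which \<open>g\<close> fixes.\<close>
  then show ?thesis
    using v[of 0] g by (simp add: functional_def tree_automorphism_def)
next
  case (2 n i)
  \<comment> \<open>Within level \<open>n\<close>, index \<open>j \<le> i\<close> has position
    \<open>2 ^ n + j \<le> m\<close>, where the functional vanishes by hypothesis.\<close>
  have "\<not> level_functional n j v" if "j \<le> i" for j
    using v[of "2 ^ n + j"] functional_position[of j n v] that 2 by simp
  then show ?thesis
    using level_functional_invariant[OF g] functional_position 2 by metis
qed

text \<open>By additivity, agreement up to \<open>k\<close> says that the first \<open>k\<close>
  functionals vanish on the difference of the portraits. In the difference for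
  \<open>x \<circ> g\<close> and \<open>y \<circ> g\<close> the portrait of \<open>g\<close>
  cancels, leaving the old difference composed with \<open>g\<close>.\<close>

lemma agree_functional_portrait_mult:
  assumes x: "tree_automorphism x" and y: "tree_automorphism y" and g: "tree_automorphism g"
    and xy: "agree (\<lambda>m f. functional m (portrait f)) k x y"
  shows "agree (\<lambda>m f. functional m (portrait f)) k (x \<circ> g) (y \<circ> g)"
  unfolding agree_def
proof (intro allI impI)
  fix m assume "m < k"
  let ?d = "\<lambda>u. portrait x u \<noteq> portrait y u"
  have "\<not> functional j ?d" if "j \<le> m" for j
    using xy that \<open>m < k\<close> unfolding agree_def functional_add by simp
  then have no: "\<not> functional m (?d \<circ> g)"
    using functional_invariant[OF g] by blast
  have eq: "?d \<circ> g = (\<lambda>u. portrait (x \<circ> g) u \<noteq> portrait (y \<circ> g) u)"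
    using x y g by (auto simp: fun_eq_iff portrait_comp)
  show "functional m (portrait (x \<circ> g)) = functional m (portrait (y \<circ> g))"
    using no unfolding eq functional_add by simp
qed

lemma functional_portrait_inject:
  assumes "tree_automorphism x" "tree_automorphism y"
    and "\<And>m. functional m (portrait x) = functional m (portrait y)"
  shows "x = y"
proof (rule portrait_inject[OF assms(1,2)])
  have "\<not> functional m (\<lambda>u. portrait x u \<noteq> portrait y u)" for m
    using assms(3) unfolding functional_add by simp
  then show "portrait x = portrait y"
    using functional_separates by blast
qed

section \<open>The uniform twin-width of the automorphism group\<close>

lemma carrier_Aut_T: "carrier Aut_T = {f. tree_automorphism f}"
  by (simp add: Aut_T_def)

text \<open>Swapping the children of every node gives the nontrivial element that the lower bound
  requires.\<close>

lemma tree_automorphism_map_Not: "tree_automorphism (map Not)"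
proof -
  have "map Not (map Not u) = u" for u
    by (induction u) auto
  then have "bij (map Not)"
    by (metis bij_betw_def inj_def surj_def)
  moreover have "parent_of (map Not u) (map Not v) \<longleftrightarrow> parent_of u v" for u v
    using bij_is_inj[OF \<open>bij (map Not)\<close>]
    by (cases v) (auto simp: parent_of_def inj_eq)
  ultimately show ?thesis
    by (simp add: tree_automorphism_def)
qed

theorem proposition6p18:
  shows "utww Aut_T = 2"
proof (rule antisym)
  show "utww Aut_T \<le> 2"
    using group_Aut_T functional_portrait_inject agree_functional_portrait_mult
    by (intro utww_le[where c = "\<lambda>m f. functional m (portrait f)"])
      (auto simp: carrier_Aut_T mult_Aut_T)
  have "\<one>\<^bsub>Aut_T\<^esub> [False] = [False]"
    by (simp add: Aut_T_def BijGroup_def)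
  then have "map Not \<noteq> \<one>\<^bsub>Aut_T\<^esub>"
    by (metis list.simps(9) list.inject)
  then show "2 \<le> utww Aut_T"
    using tree_automorphism_map_Not by (intro utww_ge[OF group_Aut_T]) (auto simp: carrier_Aut_T)
qed

end
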